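(* Let $k\ge1$ and let $\mathcal{R}$ be a binary structure of type $k$ whose age is ind-minimal. Then the kernel $\mathrm{Ker}(\mathcal{R})$ is finite. (That is, the kernel of an ind-minimal age is finite.)
   Context: A binary structure of type $k$ is $\mathcal{R}=(E,\rho_1,\dots,\rho_k)$ with binary relations on $E$. Its age $\mathrm{Age}(\mathcal{R})$ is the class of its finite restrictions up to isomorphism. $\mathrm{Ker}(\mathcal{R})$ is the set of $x\in E$ such that $\mathrm{Age}(\mathcal{R}_{\restriction E\setminus\{x\}})$ is strictly contained in $\mathrm{Age}(\mathcal{R})$. $A\subseteq E$ is an interval if for all $i$, $a,a'\in A$, $x\notin A$: $x\rho_i a\Leftrightarrow x\rho_i a'$ and $a\rho_i x\Leftrightarrow a'\rho_i x$; indecomposable means only trivial intervals. $\Omega_k$ is the class of finite binary structures of type $k$ up to isomorphism and $\mathrm{Ind}(\Omega_k)$ its indecomposable members. A class $\mathcal{C}\subseteq\Omega_k$ is ind-minimal if $\mathcal{C}\cap\mathrm{Ind}(\Omega_k)$ is infinite and for every proper hereditary subclass $\mathcal{C}'$ of $\mathcal{C}$, $\mathcal{C}'\cap\mathrm{Ind}(\Omega_k)$ is finite. *)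

theory Defs imports Main begin

record 'a bin_struct =
  base :: "'a set"
  rels :: "'a rel list"

definition binary_structure :: "nat \<Rightarrow> 'a bin_struct \<Rightarrow> bool" where
  "binary_structure k R \<longleftrightarrow>
     length (rels R) = k \<and> (\<forall>\<rho>\<in>set (rels R). \<rho> \<subseteq> base R \<times> base R)"

(* Only used for A \<subseteq> base R. *)
definition restriction :: "'a bin_struct \<Rightarrow> 'a set \<Rightarrow> 'a bin_struct" where
  "restriction R A = \<lparr>base = A, rels = map (\<lambda>\<rho>. \<rho> \<inter> A \<times> A) (rels R)\<rparr>"

definition isomorphic :: "'a bin_struct \<Rightarrow> 'b bin_struct \<Rightarrow> bool" where
  "isomorphic R S \<longleftrightarrow>
     (\<exists>f. bij_betw f (base R) (base S) \<and>
          list_all2 (\<lambda>\<rho> \<sigma>. \<forall>x\<in>base R. \<forall>y\<in>base R. (x, y) \<in> \<rho> \<longleftrightarrow> (f x, f y) \<in> \<sigma>)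
            (rels R) (rels S))"

definition embeds :: "'a bin_struct \<Rightarrow> 'b bin_struct \<Rightarrow> bool" where
  "embeds S R \<longleftrightarrow> (\<exists>A\<subseteq>base R. isomorphic S (restriction R A))"

definition interval :: "'a bin_struct \<Rightarrow> 'a set \<Rightarrow> bool" where
  "interval R A \<longleftrightarrow> A \<subseteq> base R \<and>
     (\<forall>\<rho>\<in>set (rels R). \<forall>a\<in>A. \<forall>a'\<in>A. \<forall>x\<in>base R - A.
        ((x, a) \<in> \<rho> \<longleftrightarrow> (x, a') \<in> \<rho>) \<and> ((a, x) \<in> \<rho> \<longleftrightarrow> (a', x) \<in> \<rho>))"

(* The trivial intervals are the empty set, the singletons and the whole base. *)
definition indecomposable :: "'a bin_struct \<Rightarrow> bool" where
  "indecomposable R \<longleftrightarrow>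
     (\<forall>A. interval R A \<longrightarrow> A = {} \<or> (\<exists>x. A = {x}) \<or> A = base R)"

(* The isomorphism type of a finite structure over any type is represented by the set of
   all its copies on sets of natural numbers, so that types of structures with different
   element types can be compared and the number of isomorphism types in a class is the
   cardinality of a set.  For infinite R this is not meaningful and is never used. *)
type_synonym struct_type = "nat bin_struct set"

definition iso_type :: "'a bin_struct \<Rightarrow> struct_type" where
  "iso_type R = {S. binary_structure (length (rels R)) S \<and> isomorphic S R}"

definition Omega :: "nat \<Rightarrow> struct_type set" where
  "Omega k = {iso_type S |S :: nat bin_struct. binary_structure k S \<and> finite (base S)}"

definition Ind_Omega :: "nat \<Rightarrow> struct_type set" where
  "Ind_Omega k =
     {iso_type S |S :: nat bin_struct. binary_structure k S \<and> finite (base S) \<and> indecomposable S}"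

definition Age :: "'a bin_struct \<Rightarrow> struct_type set" where
  "Age R = {iso_type (restriction R A) |A. A \<subseteq> base R \<and> finite A}"

definition Ker :: "'a bin_struct \<Rightarrow> 'a set" where
  "Ker R = {x \<in> base R. Age (restriction R (base R - {x})) \<subset> Age R}"

definition type_embeds :: "struct_type \<Rightarrow> struct_type \<Rightarrow> bool" where
  "type_embeds s t \<longleftrightarrow> (\<exists>S\<in>s. \<exists>T\<in>t. embeds S T)"

definition hereditary :: "nat \<Rightarrow> struct_type set \<Rightarrow> bool" where
  "hereditary k C \<longleftrightarrow> C \<subseteq> Omega k \<and> (\<forall>t\<in>C. \<forall>s\<in>Omega k. type_embeds s t \<longrightarrow> s \<in> C)"

definition ind_minimal :: "nat \<Rightarrow> struct_type set \<Rightarrow> bool" where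
  "ind_minimal k C \<longleftrightarrow> C \<subseteq> Omega k \<and> infinite (C \<inter> Ind_Omega k) \<and>
     (\<forall>C'. C' \<subset> C \<and> hereditary k C' \<longrightarrow> finite (C' \<inter> Ind_Omega k))"

end

theory Submission imports Defs "HOL-Library.Ramsey" "HOL-Library.Disjoint_Sets" begin

text \<open>Removing a point \<open>a\<close> of the kernel leaves a proper hereditary subclass of the age, so by
  ind-minimality the finite indecomposable restrictions of \<open>R\<close> avoiding \<open>a\<close> have bounded size.
  Every finite restriction with at least two points is a sum of smaller ones over an
  indecomposable quotient, hence a minimal bad sequence argument shows that the finite
  restrictions avoiding \<open>a\<close>, labelled by a finite set, are well-quasi-ordered by embeddability.
  Labels also record the relations to \<open>a\<close>, so embeddings extend to \<open>a\<close>.  Given further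
  kernel points \<open>x 0, x 1, \<dots>\<close>, with finite sets \<open>F n\<close> that do not embed into \<open>R\<close> without
  \<open>x n\<close>, take \<open>A n\<close> to consist of \<open>F 0, \<dots>, F n\<close> and \<open>x 0, \<dots>, x n\<close> and mark in it
  the points \<open>x 0, \<dots>, x n\<close> and the last one of them.  An embedding of \<open>A i\<close> into \<open>A j\<close> with
  \<open>i < j\<close> maps \<open>x i\<close> to \<open>x j\<close>, hence misses some \<open>x l\<close> with \<open>l \<le> i\<close>, against the choice
  of \<open>F l\<close>.\<close>

section \<open>Isomorphism types\<close>

lemma isomorphic_iff_nth:
  "isomorphic R S \<longleftrightarrow> (\<exists>f. bij_betw f (base R) (base S) \<and> length (rels R) = length (rels S) \<and>
     (\<forall>i<length (rels R). \<forall>x\<in>base R. \<forall>y\<in>base R.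
        (x, y) \<in> rels R ! i \<longleftrightarrow> (f x, f y) \<in> rels S ! i))"
  unfolding isomorphic_def list_all2_conv_all_nth by (rule refl)

lemma isomorphic_sym:
  assumes "isomorphic R S"
  shows "isomorphic S R"
proof -
  obtain f where f: "bij_betw f (base R) (base S)" "length (rels R) = length (rels S)"
    "\<forall>i<length (rels R). \<forall>x\<in>base R. \<forall>y\<in>base R.
        (x, y) \<in> rels R ! i \<longleftrightarrow> (f x, f y) \<in> rels S ! i"
    using assms unfolding isomorphic_iff_nth by blast
  let ?g = "inv_into (base R) f"
  have g: "?g x \<in> base R" "f (?g x) = x" if "x \<in> base S" for x
    using that f(1) by (auto simp: bij_betw_def inv_into_into f_inv_into_f)
  have "bij_betw ?g (base S) (base R)"
    using f(1) by (rule bij_betw_inv_into)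
  moreover have "(x, y) \<in> rels S ! i \<longleftrightarrow> (?g x, ?g y) \<in> rels R ! i"
    if "i < length (rels S)" "x \<in> base S" "y \<in> base S" for i x y
    using that g[of x] g[of y] f(2,3) by auto
  ultimately show ?thesis
    unfolding isomorphic_iff_nth using f(2) by auto
qed

lemma isomorphic_trans:
  assumes "isomorphic R S" "isomorphic S T"
  shows "isomorphic R T"
proof -
  obtain f where f: "bij_betw f (base R) (base S)" "length (rels R) = length (rels S)"
    "\<forall>i<length (rels R). \<forall>x\<in>base R. \<forall>y\<in>base R.
        (x, y) \<in> rels R ! i \<longleftrightarrow> (f x, f y) \<in> rels S ! i"
    using assms unfolding isomorphic_iff_nth by blast
  obtain g where g: "bij_betw g (base S) (base T)" "length (rels S) = length (rels T)"
    "\<forall>i<length (rels S). \<forall>x\<in>base S. \<forall>y\<in>base S.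
        (x, y) \<in> rels S ! i \<longleftrightarrow> (g x, g y) \<in> rels T ! i"
    using assms unfolding isomorphic_iff_nth by blast
  have "bij_betw (g \<circ> f) (base R) (base T)"
    using f(1) g(1) by (rule bij_betw_trans)
  moreover have "f x \<in> base S" if "x \<in> base R" for x
    using that f(1) by (auto simp: bij_betw_def)
  ultimately show ?thesis
    unfolding isomorphic_iff_nth using f(2,3) g(2,3) by (intro exI[of _ "g \<circ> f"]) auto
qed

lemma isomorphic_length: "isomorphic R S \<Longrightarrow> length (rels R) = length (rels S)"
  unfolding isomorphic_iff_nth by blast

lemma isomorphic_card: "isomorphic R S \<Longrightarrow> card (base R) = card (base S)"
  unfolding isomorphic_iff_nth by (meson bij_betw_same_card)

lemma iso_type_eqI:
  assumes "isomorphic R S"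
  shows "iso_type R = iso_type S"
proof -
  have "isomorphic T R \<longleftrightarrow> isomorphic T S" for T :: "nat bin_struct"
    using isomorphic_trans[OF _ assms] isomorphic_trans[OF _ isomorphic_sym[OF assms]] by (rule iffI)
  then show ?thesis
    using isomorphic_length[OF assms] unfolding iso_type_def by simp
qed

lemma base_restriction [simp]: "base (restriction R A) = A"
  by (simp add: restriction_def)

lemma length_rels_restriction [simp]: "length (rels (restriction R A)) = length (rels R)"
  by (simp add: restriction_def)

lemma nth_rels_restriction [simp]:
  "i < length (rels R) \<Longrightarrow> rels (restriction R A) ! i = rels R ! i \<inter> A \<times> A"
  by (simp add: restriction_def)

lemma binary_structure_restriction:
  "binary_structure k R \<Longrightarrow> binary_structure k (restriction R A)"
  unfolding binary_structure_def restriction_def by auto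

lemma restriction_restriction: "B \<subseteq> A \<Longrightarrow> restriction (restriction R A) B = restriction R B"
  unfolding restriction_def by auto

lemma isomorphic_restriction:
  assumes "inj_on f A"
    and "\<And>\<rho> x y. \<rho> \<in> set (rels R) \<Longrightarrow> x \<in> A \<Longrightarrow> y \<in> A \<Longrightarrow> (x, y) \<in> \<rho> \<longleftrightarrow> (f x, f y) \<in> \<rho>"
  shows "isomorphic (restriction R A) (restriction R (f ` A))"
  unfolding isomorphic_iff_nth using assms
  by (intro exI[of _ f]) (auto simp: bij_betw_def)

lemma embeds_isomorphic:
  assumes "embeds S T" "isomorphic T U"
  shows "embeds S U"
proof -
  obtain A where A: "A \<subseteq> base T" "isomorphic S (restriction T A)"
    using assms(1) unfolding embeds_def by blast
  obtain f where f: "bij_betw f (base T) (base U)" "length (rels T) = length (rels U)"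
    "\<forall>i<length (rels T). \<forall>x\<in>base T. \<forall>y\<in>base T.
        (x, y) \<in> rels T ! i \<longleftrightarrow> (f x, f y) \<in> rels U ! i"
    using assms(2) unfolding isomorphic_iff_nth by blast
  have "bij_betw f A (f ` A)"
    using f(1) A(1) by (meson bij_betw_subset subset_refl)
  then have "isomorphic (restriction T A) (restriction U (f ` A))"
    unfolding isomorphic_iff_nth using f(2,3) A(1) by (intro exI[of _ f]) auto
  moreover have "f ` A \<subseteq> base U"
    using f(1) A(1) by (auto simp: bij_betw_def)
  ultimately show ?thesis
    unfolding embeds_def using isomorphic_trans[OF A(2)] by blast
qed

text \<open>Isomorphism types consist of structures on sets of naturals. The copy makes the type of
  a finite structure over any element type nonempty and a member of the classes defined from such
  structures.\<close>

lemma ex_nat_copy: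
  assumes "binary_structure k R" "finite (base R)"
  obtains S :: "nat bin_struct"
  where "binary_structure k S" "finite (base S)" "isomorphic R S"
proof -
  obtain f where f: "bij_betw f (base R) {0..<card (base R)}"
    using ex_bij_betw_finite_nat[OF assms(2)] by blast
  define S where "S = \<lparr>base = {0..<card (base R)}, rels = map (\<lambda>\<rho>. map_prod f f ` \<rho>) (rels R)\<rparr>"
  have "binary_structure k S"
    using assms(1) f unfolding binary_structure_def S_def bij_betw_def by fastforce
  moreover have "isomorphic R S"
    unfolding isomorphic_iff_nth
  proof (intro exI[of _ f] conjI allI impI ballI)
    fix i x y
    assume i: "i < length (rels R)" and xy: "x \<in> base R" "y \<in> base R"
    have "rels R ! i \<subseteq> base R \<times> base R"
      using assms(1) i unfolding binary_structure_def by auto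
    moreover have "inj_on (map_prod f f) (base R \<times> base R)"
      using f by (intro map_prod_inj_on) (auto simp: bij_betw_def)
    ultimately have "map_prod f f (x, y) \<in> map_prod f f ` (rels R ! i) \<longleftrightarrow> (x, y) \<in> rels R ! i"
      using xy by (intro inj_on_image_mem_iff) auto
    then show "(x, y) \<in> rels R ! i \<longleftrightarrow> (f x, f y) \<in> rels S ! i"
      using i by (simp add: S_def)
  qed (use f in \<open>auto simp: S_def\<close>)
  ultimately show ?thesis
    using that[of S] by (auto simp: S_def)
qed

text \<open>Intervals pull back along an isomorphism; the preimage of an interval of
  \<open>S\<close> is trivial in \<open>R\<close>, and taking images carries triviality back to
  \<open>S\<close>.\<close>

lemma indecomposable_isomorphic:
  assumes "isomorphic R S" "indecomposable R"
  shows "indecomposable S"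
  unfolding indecomposable_def
proof (intro allI impI)
  fix B
  assume B: "interval S B"
  obtain f where f: "bij_betw f (base R) (base S)" "length (rels R) = length (rels S)"
    "\<forall>i<length (rels R). \<forall>x\<in>base R. \<forall>y\<in>base R.
        (x, y) \<in> rels R ! i \<longleftrightarrow> (f x, f y) \<in> rels S ! i"
    using assms(1) unfolding isomorphic_iff_nth by blast
  define A where "A = {x \<in> base R. f x \<in> B}"
  have BS: "B \<subseteq> base S" using B unfolding interval_def by blast
  have fA: "f ` A = B"
    using f(1) BS unfolding A_def bij_betw_def by (auto simp: image_iff)
  have "interval R A"
    unfolding interval_def all_set_conv_all_nth
  proof (intro conjI allI impI ballI)
    show "A \<subseteq> base R" by (auto simp: A_def)
  next
    fix i a a' x
    assume i: "i < length (rels R)" and a: "a \<in> A" "a' \<in> A" "x \<in> base R - A"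
    have "f a \<in> B" "f a' \<in> B" "f x \<in> base S - B"
      using a f(1) by (auto simp: A_def bij_betw_def)
    moreover have "rels S ! i \<in> set (rels S)" using i f(2) by simp
    ultimately have *: "(f x, f a) \<in> rels S ! i \<longleftrightarrow> (f x, f a') \<in> rels S ! i"
      "(f a, f x) \<in> rels S ! i \<longleftrightarrow> (f a', f x) \<in> rels S ! i"
      using B unfolding interval_def by blast+
    have "a \<in> base R" "a' \<in> base R" "x \<in> base R" using a by (auto simp: A_def)
    with * f(3) i show "(x, a) \<in> rels R ! i \<longleftrightarrow> (x, a') \<in> rels R ! i"
      "(a, x) \<in> rels R ! i \<longleftrightarrow> (a', x) \<in> rels R ! i" by simp_all
  qed
  then have "A = {} \<or> (\<exists>x. A = {x}) \<or> A = base R"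
    using assms(2) unfolding indecomposable_def by blast
  then show "B = {} \<or> (\<exists>x. B = {x}) \<or> B = base S"
    using fA f(1) unfolding bij_betw_def by auto
qed

lemma iso_type_in_Omega:
  assumes "binary_structure k R" "finite (base R)"
  shows "iso_type R \<in> Omega k"
proof (rule ex_nat_copy[OF assms])
  fix S :: "nat bin_struct"
  assume S: "binary_structure k S" "finite (base S)" "isomorphic R S"
  show ?thesis
    using S(1,2) iso_type_eqI[OF S(3)] unfolding Omega_def by blast
qed

lemma iso_type_in_Ind_Omega:
  assumes "binary_structure k R" "finite (base R)" "indecomposable R"
  shows "iso_type R \<in> Ind_Omega k"
proof (rule ex_nat_copy[OF assms(1,2)])
  fix S :: "nat bin_struct"
  assume S: "binary_structure k S" "finite (base S)" "isomorphic R S"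
  show ?thesis
    using S(1,2) iso_type_eqI[OF S(3)] indecomposable_isomorphic[OF S(3) assms(3)]
    unfolding Ind_Omega_def by blast
qed

text \<open>\<open>type_embeds\<close> only provides some representatives, so the embedding is
  transported along isomorphisms into a restriction of \<open>R\<close> itself, where its image is
  again a finite subset of the base.\<close>

lemma hereditary_Age:
  assumes "binary_structure k R"
  shows "hereditary k (Age R)"
  unfolding hereditary_def
proof (intro conjI ballI impI)
  show "Age R \<subseteq> Omega k"
    using assms unfolding Age_def
    by (auto intro!: iso_type_in_Omega binary_structure_restriction)
next
  fix t s
  assume "t \<in> Age R" "s \<in> Omega k" "type_embeds s t"
  obtain A where A: "A \<subseteq> base R" "finite A" "t = iso_type (restriction R A)"
    using \<open>t \<in> Age R\<close> unfolding Age_def by blast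
  obtain S0 :: "nat bin_struct" where S0: "s = iso_type S0"
    using \<open>s \<in> Omega k\<close> unfolding Omega_def by blast
  obtain S T where ST: "S \<in> s" "T \<in> t" "embeds S T"
    using \<open>type_embeds s t\<close> unfolding type_embeds_def by blast
  have "isomorphic T (restriction R A)" "isomorphic S S0"
    using ST A S0 unfolding iso_type_def by auto
  have "embeds S (restriction R A)"
    using ST(3) \<open>isomorphic T _\<close> by (rule embeds_isomorphic)
  then obtain B where B: "B \<subseteq> A" "isomorphic S (restriction (restriction R A) B)"
    unfolding embeds_def by auto
  have "isomorphic S0 (restriction R B)"
    using isomorphic_trans[OF isomorphic_sym[OF \<open>isomorphic S S0\<close>] B(2)] B(1)
    by (simp add: restriction_restriction)
  then have "s = iso_type (restriction R B)"
    using iso_type_eqI S0 by blast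
  then show "s \<in> Age R"
    using B(1) A finite_subset unfolding Age_def by blast
qed

text \<open>Cardinality is an invariant of the isomorphism type, so finitely many types leave
  finitely many sizes.\<close>

lemma indecomposable_bounded:
  assumes "binary_structure k R" "finite (Age R \<inter> Ind_Omega k)"
  obtains N where
    "\<And>Q. Q \<subseteq> base R \<Longrightarrow> finite Q \<Longrightarrow> indecomposable (restriction R Q) \<Longrightarrow> card Q \<le> N"
proof -
  \<comment> \<open>The size is read off an arbitrary representative; the choice is meaningful only
    for nonempty types, which is checked below with a copy on naturals.\<close>
  define c where "c t = card (base (SOME S. S \<in> t))" for t :: struct_type
  have "card Q \<le> Max (c ` (Age R \<inter> Ind_Omega k))"
    if Q: "Q \<subseteq> base R" "finite Q" "indecomposable (restriction R Q)" for Q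
  proof -
    let ?t = "iso_type (restriction R Q)"
    have bin: "binary_structure k (restriction R Q)"
      using assms(1) by (rule binary_structure_restriction)
    then have "?t \<in> Age R \<inter> Ind_Omega k"
      using Q iso_type_in_Ind_Omega[OF bin] unfolding Age_def by auto
    moreover have "\<exists>S. S \<in> ?t"
      by (rule ex_nat_copy[OF bin])
        (use Q bin isomorphic_sym in \<open>auto simp: iso_type_def binary_structure_def\<close>)
    then have "(SOME S. S \<in> ?t) \<in> ?t"
      by (rule someI_ex)
    then have "isomorphic (SOME S. S \<in> ?t) (restriction R Q)"
      by (auto simp: iso_type_def)
    then have "c ?t = card Q"
      unfolding c_def using isomorphic_card by fastforce
    ultimately show ?thesis
      using assms(2) by (metis Max_ge finite_imageI imageI)
  qed
  then show ?thesis by (rule that)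
qed

section \<open>Minimal bad sequences\<close>

text \<open>Nash-Williams' construction: the entries are minimised one after the other, each with
  its predecessors fixed. The assumption \<open>local\<close> says that badness can be checked on
  finite initial segments, so that it passes to the limit.\<close>

lemma minimal_bad_sequence:
  fixes bad :: "(nat \<Rightarrow> 'b) \<Rightarrow> bool" and sz :: "'b \<Rightarrow> nat"
  assumes "bad f"
    and local: "\<And>g. (\<And>n. \<exists>h. bad h \<and> (\<forall>i\<le>n. h i = g i)) \<Longrightarrow> bad g"
  obtains m where "bad m"
    "\<And>g n. bad g \<Longrightarrow> (\<And>i. i < n \<Longrightarrow> g i = m i) \<Longrightarrow> sz (m n) \<le> sz (g n)"
proof -
  \<comment> \<open>\<open>?P n F\<close> says that entry \<open>n\<close> of the bad sequence
    \<open>F\<close> is as small as its earlier entries allow; \<open>?Q\<close> freezes the entries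
    up to \<open>n\<close> for all later stages.\<close>
  let ?P = "\<lambda>n F. bad F \<and> (\<forall>g. bad g \<and> (\<forall>i<n. g i = F i) \<longrightarrow> sz (F n) \<le> sz (g n))"
  let ?Q = "\<lambda>n F G. \<forall>i\<le>n. G i = F i"
  have least: "\<exists>G. ?P n G \<and> (\<forall>i<n. G i = F i)" if F: "bad F" for n F
  proof -
    obtain G where "bad G \<and> (\<forall>i<n. G i = F i)"
      "\<forall>g. bad g \<and> (\<forall>i<n. g i = F i) \<longrightarrow> sz (G n) \<le> sz (g n)"
      using ex_has_least_nat[of "\<lambda>g. bad g \<and> (\<forall>i<n. g i = F i)" F "\<lambda>g. sz (g n)"] F by blast
    then show ?thesis by (intro exI[of _ G]) auto
  qed
  have "\<exists>F. \<forall>n. ?P n (F n) \<and> ?Q n (F n) (F (Suc n))"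
  proof (rule dependent_nat_choice)
    show "\<exists>F. ?P 0 F" using least[OF assms(1), of 0] by blast
    show "\<exists>G. ?P (Suc n) G \<and> ?Q n F G" if "?P n F" for F n
    proof -
      have "bad F" using that by blast
      from least[OF this, of "Suc n"] show ?thesis by (metis less_Suc_eq_le)
    qed
  qed
  then obtain F where F: "\<And>n. bad (F n)"
    "\<And>n g. bad g \<Longrightarrow> (\<And>i. i < n \<Longrightarrow> g i = F n i) \<Longrightarrow> sz (F n n) \<le> sz (g n)"
    "\<And>n i. i \<le> n \<Longrightarrow> F (Suc n) i = F n i" by blast
  \<comment> \<open>Entry \<open>i\<close> no longer changes after stage \<open>i\<close>, so the
    diagonal sequence agrees with \<open>F n\<close> up to \<open>n\<close> and inherits both
    badness and minimality.\<close>
  have F_eq: "F n i = F i i" if "i \<le> n" for n i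
    using that by (induction n rule: dec_induct) (auto simp: F(3))
  show ?thesis
  proof (rule that[of "\<lambda>n. F n n"])
    have "\<exists>h. bad h \<and> (\<forall>i\<le>n. h i = F i i)" for n
      using F(1)[of n] F_eq[of _ n] by (intro exI[of _ "F n"]) simp
    then show "bad (\<lambda>n. F n n)" by (rule local)
    show "sz (F n n) \<le> sz (g n)" if "bad g" "\<And>i. i < n \<Longrightarrow> g i = F i i" for g n
      by (rule F(2)[OF that(1)]) (simp add: that(2) F_eq[of _ n])
  qed
qed

text \<open>To show that every sequence in \<open>S\<close> is good, it may be assumed that
  sequences of strictly smaller elements lying below terms of \<open>f\<close> are good. The
  assumption \<open>step\<close> is applied to a minimal bad sequence, for which this is
  automatic.\<close>

lemma good_sequence_induct:
  fixes le :: "'b \<Rightarrow> 'b \<Rightarrow> bool" and sz :: "'b \<Rightarrow> nat"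
  assumes trans: "\<And>x y z. le x y \<Longrightarrow> le y z \<Longrightarrow> le x z"
    and step: "\<And>f :: nat \<Rightarrow> 'b. range f \<subseteq> S \<Longrightarrow>
      (\<And>d h. range d \<subseteq> S \<Longrightarrow> (\<And>i::nat. sz (d i) < sz (f (h i)) \<and> le (d i) (f (h i))) \<Longrightarrow>
         \<exists>i j. i < j \<and> le (d i) (d j)) \<Longrightarrow>
      \<exists>i j. i < j \<and> le (f i) (f j)"
    and f: "range f \<subseteq> S"
  shows "\<exists>i j::nat. i < j \<and> le (f i) (f j)"
proof (rule ccontr)
  define bad where "bad g \<longleftrightarrow> range g \<subseteq> S \<and> (\<forall>i j::nat. i < j \<longrightarrow> \<not> le (g i) (g j))" for g
  assume "\<not> ?thesis"
  then have "bad f" using f unfolding bad_def by blast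
  moreover have "bad g" if h: "\<And>n. \<exists>h. bad h \<and> (\<forall>i\<le>n. h i = g i)" for g
    unfolding bad_def
  proof (intro conjI allI impI subsetI)
    fix x assume "x \<in> range g"
    then obtain n where "x = g n" by blast
    with h[of n] show "x \<in> S" unfolding bad_def by (metis order_refl rangeI subsetD)
  next
    fix i j :: nat assume "i < j"
    with h[of j] show "\<not> le (g i) (g j)" unfolding bad_def by (metis less_imp_le order_refl)
  qed
  ultimately obtain m where m: "bad m"
    and min: "\<And>g n. bad g \<Longrightarrow> (\<And>i. i < n \<Longrightarrow> g i = m i) \<Longrightarrow> sz (m n) \<le> sz (g n)"
    using minimal_bad_sequence[of bad f sz] by blast
  have mS: "range m \<subseteq> S" using m unfolding bad_def by blast
  have "\<exists>i j. i < j \<and> le (m i) (m j)"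
  proof (rule step[OF mS], rule ccontr)
    fix d and h :: "nat \<Rightarrow> nat"
    assume d: "range d \<subseteq> S" "\<And>i. sz (d i) < sz (m (h i)) \<and> le (d i) (m (h i))"
      and "\<not> (\<exists>i j. i < j \<and> le (d i) (d j))"
    then have dbad: "\<not> le (d i) (d j)" if "i < j" for i j using that by blast
    \<comment> \<open>Starting \<open>d\<close> at an index where \<open>h\<close> is least ensures
      that every later \<open>d r\<close> lies below some \<open>m (h r)\<close> with
      \<open>h r \<ge> h q\<close>.\<close>
    obtain q where q: "\<And>j. h q \<le> h j"
      using ex_has_least_nat[of "\<lambda>_. True" _ h] by blast
    \<comment> \<open>The first \<open>h q\<close> terms of \<open>m\<close> are followed by
      \<open>d\<close> from \<open>q\<close> on. A good pair across the junction would by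
      transitivity give one in \<open>m\<close>, so \<open>g\<close> is bad, yet
      \<open>g (h q) = d q\<close> is smaller than \<open>m (h q)\<close>.\<close>
    define g where "g i = (if i < h q then m i else d (q + (i - h q)))" for i
    have "bad g"
      unfolding bad_def
    proof (intro conjI allI impI)
      show "range g \<subseteq> S" using d(1) mS unfolding g_def by auto
      fix i j :: nat assume ij: "i < j"
      consider "j < h q" | "h q \<le> i" | "i < h q" "h q \<le> j" by linarith
      then show "\<not> le (g i) (g j)"
      proof cases
        case 1 then show ?thesis using m ij unfolding bad_def g_def by simp
      next
        case 2 then show ?thesis using ij dbad unfolding g_def by simp
      next
        case 3
        let ?r = "q + (j - h q)"
        have "i < h ?r" using 3 q[of ?r] by simp
        then have "\<not> le (m i) (m (h ?r))" using m unfolding bad_def by blast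
        then show ?thesis using 3 d(2)[of ?r] trans unfolding g_def by auto
      qed
    qed
    then have "sz (m (h q)) \<le> sz (g (h q))"
      by (rule min) (simp add: g_def)
    then show False using d(2)[of q] by (simp add: g_def)
  qed
  then show False using m unfolding bad_def by blast
qed

text \<open>By Ramsey's theorem: if every pair failed some \<open>P l\<close>, colouring pairs by
  the first failing \<open>l\<close> would give an infinite homogeneous set, and hence a subsequence
  along which one fixed \<open>P l\<close> always fails. This replaces closure of well-quasi-orders
  under finite products.\<close>

lemma good_pair_conj:
  fixes P :: "nat \<Rightarrow> nat \<Rightarrow> nat \<Rightarrow> bool"
  assumes "\<And>l (\<phi> :: nat \<Rightarrow> nat). l < m \<Longrightarrow> strict_mono \<phi> \<Longrightarrow> \<exists>i j. i < j \<and> P l (\<phi> i) (\<phi> j)"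
  shows "\<exists>i j. i < j \<and> (\<forall>l<m. P l i j)"
proof (rule ccontr)
  assume "\<not> ?thesis"
  then have fail: "\<exists>l<m. \<not> P l i j" if "i < j" for i j using that by blast
  \<comment> \<open>Colours are attached to unordered pairs, whose order is recovered by
    \<open>Min\<close> and \<open>Max\<close>.\<close>
  define c where "c X = (LEAST l. \<not> P l (Min X) (Max X))" for X
  have c: "c {i, j} < m \<and> \<not> P (c {i, j}) i j" if ij: "i < j" for i j
  proof -
    have mm: "Min {i, j} = i" "Max {i, j} = j" using ij by auto
    obtain l where l: "l < m" "\<not> P l i j" using fail[OF ij] by blast
    have "c {i, j} \<le> l" unfolding c_def mm using l(2) by (rule Least_le)
    moreover have "\<not> P (c {i, j}) i j" unfolding c_def mm using l(2) by (rule LeastI)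
    ultimately show ?thesis using l by simp
  qed
  have "\<forall>x\<in>UNIV. \<forall>y\<in>UNIV. x \<noteq> y \<longrightarrow> c {x, y} < m"
  proof (intro ballI impI)
    fix i j :: nat assume "i \<noteq> j"
    then consider "i < j" | "j < i" by linarith
    then show "c {i, j} < m"
      using c[of i j] c[of j i] by cases (simp_all add: insert_commute)
  qed
  from Ramsey2[OF infinite_UNIV_nat this] obtain Y t where Y: "infinite Y" "t < m"
    "\<forall>x\<in>Y. \<forall>y\<in>Y. x \<noteq> y \<longrightarrow> c {x, y} = t" by blast
  obtain \<phi> :: "nat \<Rightarrow> nat" where \<phi>: "strict_mono \<phi>" "\<forall>n. \<phi> n \<in> Y"
    using infinite_enumerate[OF Y(1)] by blast
  obtain i j where ij: "i < j" "P t (\<phi> i) (\<phi> j)"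
    using assms[OF Y(2) \<phi>(1)] by blast
  have "\<phi> i < \<phi> j" using ij \<phi>(1) by (simp add: strict_mono_less)
  moreover from this have "c {\<phi> i, \<phi> j} = t" using Y(3) \<phi>(2) by simp
  ultimately show False using c[of "\<phi> i" "\<phi> j"] ij(2) by simp
qed

section \<open>Decomposition into intervals\<close>

lemma interval_restriction:
  "interval (restriction R Q) I \<longleftrightarrow> I \<subseteq> Q \<and>
     (\<forall>\<rho>\<in>set (rels R). \<forall>a\<in>I. \<forall>a'\<in>I. \<forall>x\<in>Q - I.
        ((x, a) \<in> \<rho> \<longleftrightarrow> (x, a') \<in> \<rho>) \<and> ((a, x) \<in> \<rho> \<longleftrightarrow> (a', x) \<in> \<rho>))"
proof (cases "I \<subseteq> Q")
  case True
  let ?hom = "\<lambda>\<rho> a a' x. ((x, a) \<in> \<rho> \<longleftrightarrow> (x, a') \<in> \<rho>) \<and> ((a, x) \<in> \<rho> \<longleftrightarrow> (a', x) \<in> \<rho>)"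
  have "interval (restriction R Q) I \<longleftrightarrow>
      (\<forall>\<rho>\<in>set (rels R). \<forall>a\<in>I. \<forall>a'\<in>I. \<forall>x\<in>Q - I. ?hom (\<rho> \<inter> Q \<times> Q) a a' x)"
    using True by (simp add: interval_def restriction_def)
  also have "\<dots> \<longleftrightarrow> (\<forall>\<rho>\<in>set (rels R). \<forall>a\<in>I. \<forall>a'\<in>I. \<forall>x\<in>Q - I. ?hom \<rho> a a' x)"
    using True by (intro ball_cong refl) auto
  finally show ?thesis using True by simp
qed (simp add: interval_def)

text \<open>The two arguments are exchanged one at a time: \<open>y\<close> lies outside the
  interval \<open>B\<close>, and \<open>x'\<close> outside the interval \<open>C\<close>.\<close>

lemma interval_blocks_cong:
  assumes P: "partition_on A P" "\<And>B. B \<in> P \<Longrightarrow> interval (restriction R A) B"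
    and BC: "B \<in> P" "C \<in> P" "B \<noteq> C"
    and mem: "x \<in> B" "x' \<in> B" "y \<in> C" "y' \<in> C" and "\<rho> \<in> set (rels R)"
  shows "(x, y) \<in> \<rho> \<longleftrightarrow> (x', y') \<in> \<rho>"
proof -
  have "B \<inter> C = {}" "B \<subseteq> A" "C \<subseteq> A"
    using P(1) BC by (auto simp: partition_on_def disjoint_def)
  then have "x' \<in> A - C" "y \<in> A - B" using mem by blast+
  then have "(x, y) \<in> \<rho> \<longleftrightarrow> (x', y) \<in> \<rho>" "(x', y) \<in> \<rho> \<longleftrightarrow> (x', y') \<in> \<rho>"
    using P(2)[OF BC(1), unfolded interval_restriction, THEN conjunct2, rule_format, OF \<open>\<rho> \<in> _\<close> mem(1,2)]
      P(2)[OF BC(2), unfolded interval_restriction, THEN conjunct2, rule_format, OF \<open>\<rho> \<in> _\<close> mem(3,4)]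
    by simp_all
  then show ?thesis by simp
qed

text \<open>A partition into intervals with the least possible number \<open>\<ge> 2\<close> of blocks has an
  indecomposable quotient: a nontrivial interval of the quotient would allow merging blocks.\<close>

lemma ex_indecomposable_quotient:
  assumes "finite A" "card A \<ge> 2"
  obtains P \<tau> where "partition_on A P" "card P \<ge> 2"
    "\<And>B. B \<in> P \<Longrightarrow> interval (restriction R A) B"
    "\<And>B. B \<in> P \<Longrightarrow> \<tau> B \<in> B" "indecomposable (restriction R (\<tau> ` P))"
proof -
  let ?ok = "\<lambda>P. partition_on A P \<and> card P \<ge> 2 \<and> (\<forall>B\<in>P. interval (restriction R A) B)"
  \<comment> \<open>The partition into singletons shows that there is a partition to minimise
    over.\<close>
  have "card ((\<lambda>x. {x}) ` A) = card A" by (simp add: card_image)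
  then have "?ok ((\<lambda>x. {x}) ` A)"
    using assms unfolding interval_restriction
    by (auto simp: partition_on_def disjoint_def)
  from ex_has_least_nat[of ?ok, OF this, of card] obtain P where P: "?ok P"
    and least: "\<And>P'. ?ok P' \<Longrightarrow> card P \<le> card P'" by blast
  have fin: "finite P" using P assms finite_elements by blast
  have "\<forall>B\<in>P. \<exists>x. x \<in> B" using P unfolding partition_on_def by (metis ex_in_conv)
  then obtain \<tau> where \<tau>: "\<And>B. B \<in> P \<Longrightarrow> \<tau> B \<in> B" by metis
  have disj: "B = C" if "B \<in> P" "C \<in> P" "x \<in> B" "x \<in> C" for B C x
    using that P unfolding partition_on_def disjoint_def by blast
  have inj: "inj_on \<tau> P" using \<tau> disj by (metis inj_onI)
  have cong: "(x, y) \<in> \<rho> \<longleftrightarrow> (\<tau> B, \<tau> C) \<in> \<rho>"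
    if "B \<in> P" "C \<in> P" "B \<noteq> C" "x \<in> B" "y \<in> C" "\<rho> \<in> set (rels R)" for B C x y \<rho>
    by (rule interval_blocks_cong[of A P R]) (use P \<tau> that in auto)
  have "indecomposable (restriction R (\<tau> ` P))"
    unfolding indecomposable_def
  proof (intro allI impI, rule ccontr)
    fix I
    assume I: "interval (restriction R (\<tau> ` P)) I"
      and nontriv: "\<not> (I = {} \<or> (\<exists>x. I = {x}) \<or> I = base (restriction R (\<tau> ` P)))"
    \<comment> \<open>The blocks represented in \<open>I\<close>. Relations between distinct blocks
      are determined by representatives, so their union is an interval as well.\<close>
    define K where "K = {B \<in> P. \<tau> B \<in> I}"
    have KP: "K \<subseteq> P" by (auto simp: K_def)
    have IK: "I = \<tau> ` K" using I unfolding K_def interval_restriction by blast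
    have finK: "finite K" using KP fin by (rule finite_subset)
    have "card K \<noteq> 0" "card K \<noteq> 1" "K \<noteq> P"
      using nontriv IK finK by (auto simp: card_1_singleton_iff)
    then have cK: "card K \<ge> 2" by linarith
    obtain D where D: "D \<in> P - K" using KP \<open>K \<noteq> P\<close> by blast
    have UK: "interval (restriction R A) (\<Union>K)"
      unfolding interval_restriction
    proof (intro conjI ballI)
      show "\<Union>K \<subseteq> A" using KP P unfolding partition_on_def by blast
    next
      fix \<rho> a a' x
      assume \<rho>: "\<rho> \<in> set (rels R)" and a: "a \<in> \<Union>K" "a' \<in> \<Union>K" and x: "x \<in> A - \<Union>K"
      obtain B where B: "B \<in> P" "x \<in> B" using x P unfolding partition_on_def by blast
      have BK: "B \<notin> K" using x B by blast
      obtain C C' where C: "C \<in> K" "a \<in> C" "C' \<in> K" "a' \<in> C'" using a by blast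
      have "\<tau> B \<in> \<tau> ` P - I" "\<tau> C \<in> I" "\<tau> C' \<in> I" using B BK C unfolding K_def by auto
      then have *: "(\<tau> B, \<tau> C) \<in> \<rho> \<longleftrightarrow> (\<tau> B, \<tau> C') \<in> \<rho>"
        "(\<tau> C, \<tau> B) \<in> \<rho> \<longleftrightarrow> (\<tau> C', \<tau> B) \<in> \<rho>"
        using I[unfolded interval_restriction, THEN conjunct2, rule_format, OF \<rho>] by blast+
      have CP: "C \<in> P" "C' \<in> P" "B \<noteq> C" "B \<noteq> C'" using C KP BK by auto
      show "(x, a) \<in> \<rho> \<longleftrightarrow> (x, a') \<in> \<rho>" "(a, x) \<in> \<rho> \<longleftrightarrow> (a', x) \<in> \<rho>"
        using cong[OF B(1) CP(1) CP(3) B(2) C(2) \<rho>] cong[OF B(1) CP(2) CP(4) B(2) C(4) \<rho>]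
          cong[OF CP(1) B(1) CP(3)[symmetric] C(2) B(2) \<rho>]
          cong[OF CP(2) B(1) CP(4)[symmetric] C(4) B(2) \<rho>] * by simp_all
    qed
    \<comment> \<open>Merging the at least two blocks of \<open>K\<close> lowers the number of
      blocks, while the block \<open>D\<close> outside \<open>K\<close> keeps it at least 2; this
      contradicts the choice of \<open>P\<close>.\<close>
    define P' where "P' = insert (\<Union>K) (P - K)"
    have Kne: "K \<noteq> {}" using cK by auto
    have UK_not: "\<Union>K \<notin> P - K"
    proof
      assume UKP: "\<Union>K \<in> P - K"
      obtain B where "B \<in> K" using Kne by blast
      then show False using disj[of B "\<Union>K" "\<tau> B"] \<tau>[of B] KP UKP by blast
    qed
    have "partition_on A P'"
      unfolding partition_on_def
    proof (intro conjI)
      show "\<Union>P' = A" using P KP unfolding P'_def partition_on_def by blast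
      obtain B where "B \<in> K" using Kne by blast
      then have "\<tau> B \<in> \<Union>K" using \<tau> KP by blast
      then have "\<Union>K \<noteq> {}" by blast
      then show "{} \<notin> P'" using P unfolding P'_def partition_on_def by simp
      show "disjoint P'"
        unfolding disjoint_def
      proof (intro ballI impI)
        fix X Y assume XY: "X \<in> P'" "Y \<in> P'" "X \<noteq> Y"
        show "X \<inter> Y = {}"
        proof (rule ccontr)
          assume "X \<inter> Y \<noteq> {}"
          then obtain z where z: "z \<in> X" "z \<in> Y" by blast
          have K_disj: False if "D \<in> P - K" "z \<in> D" "z \<in> \<Union>K" for D
          proof -
            obtain C where "C \<in> K" "z \<in> C" using \<open>z \<in> \<Union>K\<close> by blast
            then show False using disj[of C D z] KP that(1,2) by blast
          qed
          consider "X = \<Union>K" "Y \<in> P - K" | "Y = \<Union>K" "X \<in> P - K" | "X \<in> P" "Y \<in> P"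
            using XY unfolding P'_def by blast
          then show False
            using K_disj[of X] K_disj[of Y] disj[of X Y z] z XY(3) by cases simp_all
        qed
      qed
    qed
    moreover have "\<forall>B\<in>P'. interval (restriction R A) B" using UK P unfolding P'_def by blast
    moreover have cP': "card P' = Suc (card (P - K))"
      unfolding P'_def using UK_not fin by simp
    moreover have "card (P - K) \<noteq> 0" using D fin by (metis card_0_eq empty_iff finite_Diff)
    ultimately have "card P \<le> card P'" by (intro least) auto
    moreover have "card (P - K) = card P - card K" "card K \<le> card P"
      using KP finK fin by (auto simp: card_Diff_subset card_mono)
    ultimately show False using cP' cK by linarith
  qed
  then show ?thesis using that[of P \<tau>] P \<tau> by blast
qed

text \<open>Blocks \<open>c l\<close> with representatives \<open>t l\<close> are numbered so that
  decompositions of different sets can be compared index by index. For \<open>m \<ge> 2\<close> the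
  blocks are proper subsets, which allows induction on size; \<open>m \<le> 1\<close> covers the
  empty set and singletons, which cannot be split further.\<close>

definition block_decomposition ::
  "'a bin_struct \<Rightarrow> 'a set \<Rightarrow> nat \<Rightarrow> (nat \<Rightarrow> 'a) \<Rightarrow> (nat \<Rightarrow> 'a set) \<Rightarrow> bool" where
  "block_decomposition R A m t c \<longleftrightarrow>
     A = (\<Union>l<m. c l) \<and> disjoint_family_on c {..<m} \<and> (\<forall>l<m. t l \<in> c l) \<and>
     (m \<le> 1 \<longrightarrow> (\<forall>l<m. c l = {t l})) \<and> (m \<ge> 2 \<longrightarrow> (\<forall>l<m. c l \<subset> A)) \<and>
     (\<forall>\<rho>\<in>set (rels R). \<forall>l<m. \<forall>l'<m. l \<noteq> l' \<longrightarrow>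
        (\<forall>x\<in>c l. \<forall>y\<in>c l'. (x, y) \<in> \<rho> \<longleftrightarrow> (t l, t l') \<in> \<rho>))"

lemma block_decompositionD:
  assumes "block_decomposition R A m t c"
  shows "A = (\<Union>l<m. c l)" "disjoint_family_on c {..<m}"
    "\<And>l. m \<le> 1 \<Longrightarrow> l < m \<Longrightarrow> c l = {t l}" "\<And>l. m \<ge> 2 \<Longrightarrow> l < m \<Longrightarrow> c l \<subset> A"
    "\<And>\<rho> l l' x y. \<rho> \<in> set (rels R) \<Longrightarrow> l < m \<Longrightarrow> l' < m \<Longrightarrow> l \<noteq> l' \<Longrightarrow> x \<in> c l \<Longrightarrow> y \<in> c l' \<Longrightarrow>
       (x, y) \<in> \<rho> \<longleftrightarrow> (t l, t l') \<in> \<rho>"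
  using assms unfolding block_decomposition_def by blast+

text \<open>The representatives of an indecomposable quotient form an indecomposable restriction
  inside \<open>E\<close>, so there are at most \<open>N\<close> blocks. With \<open>Suc N\<close> a
  single block meets the bound without any appeal to \<open>N\<close>.\<close>

lemma ex_block_decomposition:
  assumes "A \<subseteq> E" "finite A"
    and N: "\<And>Q. Q \<subseteq> E \<Longrightarrow> finite Q \<Longrightarrow> indecomposable (restriction R Q) \<Longrightarrow> card Q \<le> N"
  shows "\<exists>m t c. m \<le> Suc N \<and> block_decomposition R A m t c"
proof (cases "card A \<ge> 2")
  case False
  then consider "A = {}" | x where "A = {x}"
    using \<open>finite A\<close> by (metis One_nat_def card_0_eq card_1_singletonE less_2_cases not_le)
  then show ?thesis
  proof cases
    case 1
    then show ?thesis
      by (intro exI[of _ 0]) (simp add: block_decomposition_def disjoint_family_on_def)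
  next
    case 2
    then show ?thesis
      by (intro exI[of _ 1] exI[of _ "\<lambda>_. x"] exI[of _ "\<lambda>_. {x}"])
        (simp add: block_decomposition_def disjoint_family_on_def lessThan_Suc)
  qed
next
  case True
  from ex_indecomposable_quotient[OF \<open>finite A\<close> True, of R]
  obtain P \<tau> where P: "partition_on A P" "card P \<ge> 2"
    "\<And>B. B \<in> P \<Longrightarrow> interval (restriction R A) B"
    "\<And>B. B \<in> P \<Longrightarrow> \<tau> B \<in> B" "indecomposable (restriction R (\<tau> ` P))" by blast
  have fin: "finite P" using P(1) \<open>finite A\<close> finite_elements by blast
  have disj: "B = C" if "B \<in> P" "C \<in> P" "x \<in> B" "x \<in> C" for B C x
    using that P(1) unfolding partition_on_def disjoint_def by blast
  have "inj_on \<tau> P" using P(4) disj by (metis inj_onI)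
  then have "card P = card (\<tau> ` P)" by (simp add: card_image)
  also have "\<tau> ` P \<subseteq> A" using P(1,4) unfolding partition_on_def by blast
  then have "card (\<tau> ` P) \<le> N"
    using P(5) fin \<open>A \<subseteq> E\<close> by (intro N) auto
  finally have "card P \<le> N" .
  obtain e where e: "bij_betw e {0..<card P} P"
    using ex_bij_betw_nat_finite[OF fin] by blast
  have eP: "e l \<in> P" if "l < card P" for l using e that by (auto simp: bij_betw_def)
  have e_neq: "e l \<noteq> e l'" if "l < card P" "l' < card P" "l \<noteq> l'" for l l'
    using e that by (auto simp: bij_betw_def inj_on_def)
  have eim: "e ` {..<card P} = P" using e by (auto simp: bij_betw_def atLeast0LessThan)
  have "block_decomposition R A (card P) (\<lambda>l. \<tau> (e l)) e"
    unfolding block_decomposition_def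
  proof (intro conjI allI impI ballI)
    show "A = (\<Union>l<card P. e l)" using P(1) eim unfolding partition_on_def by simp
    show "disjoint_family_on e {..<card P}"
      unfolding disjoint_family_on_def using disj eP e_neq by (metis disjoint_iff lessThan_iff)
    fix l assume l: "l < card P"
    show "\<tau> (e l) \<in> e l" using P(4) eP[OF l] .
    show "e l = {\<tau> (e l)}" if "card P \<le> 1" using that P(2) by simp
    show "e l \<subset> A"
    proof -
      obtain l' where "l' < card P" "l' \<noteq> l"
        using P(2) by (metis One_nat_def Suc_1 Suc_le_eq less_Suc_eq less_trans n_not_Suc_n zero_less_Suc)
      then have "\<tau> (e l') \<in> A - e l"
        using disj[of "e l" "e l'" "\<tau> (e l')"] P(4) eP e_neq l \<open>\<tau> ` P \<subseteq> A\<close> by blast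
      moreover have "e l \<subseteq> A" using eP[OF l] P(1) unfolding partition_on_def by blast
      ultimately show ?thesis by blast
    qed
    show "(x, y) \<in> \<rho> \<longleftrightarrow> (\<tau> (e l), \<tau> (e l')) \<in> \<rho>"
      if "\<rho> \<in> set (rels R)" "l' < card P" "l \<noteq> l'" "x \<in> e l" "y \<in> e l'" for \<rho> l' x y
      by (rule interval_blocks_cong[of A P R "e l" "e l'"])
        (use P eP e_neq l that in auto)
  qed
  then show ?thesis using \<open>card P \<le> N\<close> by (meson le_SucI)
qed

section \<open>Labelled substructures\<close>

text \<open>Embeddability between labelled restrictions of the same structure \<open>R\<close>, with
  labels preserved exactly. Each set carries its own labelling, so one point may be labelled
  differently in different terms of a sequence.\<close>

definition labelled_le ::
  "'a bin_struct \<Rightarrow> 'a set \<times> ('a \<Rightarrow> 'c) \<Rightarrow> 'a set \<times> ('a \<Rightarrow> 'c) \<Rightarrow> bool" where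
  "labelled_le R X Y \<longleftrightarrow> (\<exists>f. inj_on f (fst X) \<and> f ` fst X \<subseteq> fst Y \<and>
     (\<forall>x\<in>fst X. snd Y (f x) = snd X x) \<and>
     (\<forall>\<rho>\<in>set (rels R). \<forall>x\<in>fst X. \<forall>y\<in>fst X. (x, y) \<in> \<rho> \<longleftrightarrow> (f x, f y) \<in> \<rho>))"

lemma labelled_le_subset: "A \<subseteq> B \<Longrightarrow> labelled_le R (A, \<nu>) (B, \<nu>)"
  unfolding labelled_le_def by (intro exI[of _ id]) auto

lemma labelled_le_trans:
  assumes "labelled_le R X Y" "labelled_le R Y Z"
  shows "labelled_le R X Z"
proof -
  obtain f where f: "inj_on f (fst X)" "f ` fst X \<subseteq> fst Y"
     "\<forall>x\<in>fst X. snd Y (f x) = snd X x"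
     "\<forall>\<rho>\<in>set (rels R). \<forall>x\<in>fst X. \<forall>y\<in>fst X. (x, y) \<in> \<rho> \<longleftrightarrow> (f x, f y) \<in> \<rho>"
    using assms(1) unfolding labelled_le_def by blast
  obtain g where g: "inj_on g (fst Y)" "g ` fst Y \<subseteq> fst Z"
     "\<forall>x\<in>fst Y. snd Z (g x) = snd Y x"
     "\<forall>\<rho>\<in>set (rels R). \<forall>x\<in>fst Y. \<forall>y\<in>fst Y. (x, y) \<in> \<rho> \<longleftrightarrow> (g x, g y) \<in> \<rho>"
    using assms(2) unfolding labelled_le_def by blast
  have "inj_on (g \<circ> f) (fst X)"
    using f(1,2) g(1) by (meson comp_inj_on inj_on_subset)
  moreover have "f x \<in> fst Y" if "x \<in> fst X" for x using f(2) that by blast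
  ultimately show ?thesis
    unfolding labelled_le_def using f(3,4) g(2,3,4)
    by (intro exI[of _ "g \<circ> f"]) auto
qed

text \<open>Embeddings of corresponding blocks are glued. Pairs inside one block are handled by its
  embedding, and pairs across blocks by \<open>cong\<close>, as images stay in blocks with the same
  indices.\<close>

lemma labelled_le_blocks:
  fixes \<nu> :: "'a \<Rightarrow> 'c" and m :: nat
  assumes A: "A = (\<Union>l<m. c l)" "disjoint_family_on c {..<m}"
    and B: "B = (\<Union>l<m. d l)" "disjoint_family_on d {..<m}"
    and cong: "\<And>\<rho> l l' x y x' y'. \<rho> \<in> set (rels R) \<Longrightarrow> l < m \<Longrightarrow> l' < m \<Longrightarrow> l \<noteq> l' \<Longrightarrow>
       x \<in> c l \<Longrightarrow> y \<in> c l' \<Longrightarrow> x' \<in> d l \<Longrightarrow> y' \<in> d l' \<Longrightarrow> (x, y) \<in> \<rho> \<longleftrightarrow> (x', y') \<in> \<rho>"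
    and le: "\<And>l. l < m \<Longrightarrow> labelled_le R (c l, \<nu>) (d l, \<mu>)"
  shows "labelled_le R (A, \<nu>) (B, \<mu>)"
proof -
  have "\<forall>l\<in>{..<m}. \<exists>f. inj_on f (c l) \<and> f ` c l \<subseteq> d l \<and> (\<forall>x\<in>c l. \<mu> (f x) = \<nu> x) \<and>
     (\<forall>\<rho>\<in>set (rels R). \<forall>x\<in>c l. \<forall>y\<in>c l. (x, y) \<in> \<rho> \<longleftrightarrow> (f x, f y) \<in> \<rho>)"
    using le unfolding labelled_le_def by simp
  from bchoice[OF this] obtain g where h: "\<forall>l\<in>{..<m}. inj_on (g l) (c l) \<and> g l ` c l \<subseteq> d l \<and>
     (\<forall>x\<in>c l. \<mu> (g l x) = \<nu> x) \<and>
     (\<forall>\<rho>\<in>set (rels R). \<forall>x\<in>c l. \<forall>y\<in>c l. (x, y) \<in> \<rho> \<longleftrightarrow> (g l x, g l y) \<in> \<rho>)"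
    by blast
  have g: "\<And>l. l < m \<Longrightarrow> inj_on (g l) (c l)"
    "\<And>l x. l < m \<Longrightarrow> x \<in> c l \<Longrightarrow> g l x \<in> d l"
    "\<And>l x. l < m \<Longrightarrow> x \<in> c l \<Longrightarrow> \<mu> (g l x) = \<nu> x"
    "\<And>l \<rho> x y. l < m \<Longrightarrow> \<rho> \<in> set (rels R) \<Longrightarrow> x \<in> c l \<Longrightarrow> y \<in> c l \<Longrightarrow>
       (x, y) \<in> \<rho> \<longleftrightarrow> (g l x, g l y) \<in> \<rho>"
    using h by blast+
  have "\<forall>x\<in>A. \<exists>l. l < m \<and> x \<in> c l" using A(1) by blast
  from bchoice[OF this] obtain idx where idx: "\<And>x. x \<in> A \<Longrightarrow> idx x < m \<and> x \<in> c (idx x)"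
    by blast
  define f where "f x = g (idx x) x" for x
  have fd: "f x \<in> d (idx x)" if "x \<in> A" for x using g(2) idx[OF that] unfolding f_def by blast
  have "inj_on f A"
  proof (rule inj_onI)
    fix x y assume xy: "x \<in> A" "y \<in> A" "f x = f y"
    \<comment> \<open>Points with a common image come from the same block, because the target blocks
      are disjoint; there the local embedding is injective.\<close>
    then have "d (idx x) \<inter> d (idx y) \<noteq> {}" using fd[of x] fd[of y] by auto
    then have eq: "idx x = idx y"
      using B(2) idx[of x] idx[of y] xy unfolding disjoint_family_on_def by auto
    show "x = y"
      using xy idx[of x] idx[of y] eq inj_onD[OF g(1), of "idx x" x y] unfolding f_def by simp
  qed
  moreover have "f ` A \<subseteq> B" using fd idx B(1) by blast
  moreover have "(x, y) \<in> \<rho> \<longleftrightarrow> (f x, f y) \<in> \<rho>"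
    if "\<rho> \<in> set (rels R)" "x \<in> A" "y \<in> A" for \<rho> x y
  proof (cases "idx x = idx y")
    case True
    then show ?thesis
      using that idx[of x] idx[of y] g(4)[of "idx x" \<rho> x y] unfolding f_def by simp
  next
    case False
    then show ?thesis
      using that idx[of x] idx[of y] fd[of x] fd[of y] cong[of \<rho> "idx x" "idx y"] by simp
  qed
  ultimately show ?thesis
    unfolding labelled_le_def using g(3) idx
    by (intro exI[of _ f]) (auto simp: f_def)
qed

text \<open>Bounded quotients admit finitely many patterns, so a subsequence has a constant one.
  Along it the proper blocks are good by the induction hypothesis, and a pair of terms good for all
  block indices at once is glued to an embedding.\<close>

theorem labelled_substructures_good:
  fixes \<nu> :: "nat \<Rightarrow> 'a \<Rightarrow> 'c" and R :: "'a bin_struct"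
  assumes N: "\<And>Q. Q \<subseteq> E \<Longrightarrow> finite Q \<Longrightarrow> indecomposable (restriction R Q) \<Longrightarrow> card Q \<le> N"
    and A: "\<And>i. A i \<subseteq> E" "\<And>i. finite (A i)"
    and L: "finite L" "\<And>i x. \<nu> i x \<in> L"
  shows "\<exists>i j. i < j \<and> labelled_le R (A i, \<nu> i) (A j, \<nu> j)"
proof -
  define S where "S = {X :: 'a set \<times> ('a \<Rightarrow> 'c). fst X \<subseteq> E \<and> finite (fst X) \<and> range (snd X) \<subseteq> L}"
  have range: "range (\<lambda>i. (A i, \<nu> i)) \<subseteq> S"
    using A L(2) by (auto simp: S_def dest: subsetD[OF A(1)])
  show ?thesis
  proof (rule good_sequence_induct[where le = "labelled_le R" and sz = "\<lambda>X. card (fst X)",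
        OF labelled_le_trans _ range])
    fix f :: "nat \<Rightarrow> 'a set \<times> ('a \<Rightarrow> 'c)"
    assume f: "range f \<subseteq> S"
      and IH: "\<And>d h. range d \<subseteq> S \<Longrightarrow>
      (\<And>i::nat. card (fst (d i)) < card (fst (f (h i))) \<and> labelled_le R (d i) (f (h i))) \<Longrightarrow>
         \<exists>i j. i < j \<and> labelled_le R (d i) (d j)"
    define B \<mu> where "B i = fst (f i)" and "\<mu> i = snd (f i)" for i
    have fB: "f i = (B i, \<mu> i)" for i by (simp add: B_def \<mu>_def)
    have B: "B i \<subseteq> E" "finite (B i)" and \<mu>: "\<mu> i x \<in> L" for i x
      using f unfolding B_def \<mu>_def S_def by auto
    have "\<forall>i. \<exists>m t c. m \<le> Suc N \<and> block_decomposition R (B i) m t c"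
      using ex_block_decomposition[OF B N] by blast
    then obtain m t c where mN: "\<And>i. m i \<le> Suc N"
      and D: "\<And>i. block_decomposition R (B i) (m i) (t i) (c i)" by metis
    \<comment> \<open>The pattern records the number of blocks and the relations and labels of the
      representatives. The loops (\<open>l = l'\<close>) and the labels serve the one-point
      case.\<close>
    define pat where "pat i = (m i,
      {(\<rho>, l, l'). \<rho> \<in> set (rels R) \<and> l < m i \<and> l' < m i \<and> (t i l, t i l') \<in> \<rho>},
      (\<lambda>l. (l, \<mu> i (t i l))) ` {..<m i})" for i
    have "range pat \<subseteq> {..Suc N} \<times> Pow (set (rels R) \<times> {..Suc N} \<times> {..Suc N}) \<times> Pow ({..Suc N} \<times> L)"
      using \<mu> mN less_le_trans[OF _ mN] unfolding pat_def by (auto intro: less_imp_le)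
    then have "finite (range pat)"
      by (rule finite_subset) (use L in auto)
    then obtain i0 where "infinite {i. pat i = pat i0}"
      using pigeonhole_infinite[of UNIV pat] by auto
    then obtain \<phi> :: "nat \<Rightarrow> nat" where \<phi>: "strict_mono \<phi>" "\<And>n. pat (\<phi> n) = pat i0"
      using infinite_enumerate by (metis (mono_tags, lifting) mem_Collect_eq)
    define M where "M = m i0"
    have m\<phi>: "m (\<phi> n) = M" for n using \<phi>(2)[of n] unfolding pat_def M_def by simp
    have rel: "(t (\<phi> i) l, t (\<phi> i) l') \<in> \<rho> \<longleftrightarrow> (t (\<phi> j) l, t (\<phi> j) l') \<in> \<rho>"
      if "\<rho> \<in> set (rels R)" "l < M" "l' < M" for i j l l' \<rho>
    proof -
      have "fst (snd (pat (\<phi> i))) = fst (snd (pat (\<phi> j)))" using \<phi>(2) by simp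
      from arg_cong[OF this, of "\<lambda>X. (\<rho>, l, l') \<in> X"] show ?thesis
        using that m\<phi> unfolding pat_def by simp
    qed
    have lab: "\<mu> (\<phi> i) (t (\<phi> i) l) = \<mu> (\<phi> j) (t (\<phi> j) l)" if "l < M" for i j l
    proof -
      have "snd (snd (pat (\<phi> i))) = snd (snd (pat (\<phi> j)))" using \<phi>(2) by simp
      moreover have "(l, \<mu> (\<phi> i) (t (\<phi> i) l)) \<in> snd (snd (pat (\<phi> i)))"
        using that m\<phi>[of i] unfolding pat_def by simp
      ultimately have "(l, \<mu> (\<phi> i) (t (\<phi> i) l)) \<in> snd (snd (pat (\<phi> j)))"
        by simp
      then show ?thesis unfolding pat_def by auto
    qed
    let ?le = "\<lambda>l i j. labelled_le R (c (\<phi> i) l, \<mu> (\<phi> i)) (c (\<phi> j) l, \<mu> (\<phi> j))"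
    have "\<exists>i j. i < j \<and> (\<forall>l<M. ?le l i j)"
    proof (rule good_pair_conj)
      fix l and \<psi> :: "nat \<Rightarrow> nat"
      assume l: "l < M" and \<psi>: "strict_mono \<psi>"
      show "\<exists>i j. i < j \<and> ?le l (\<psi> i) (\<psi> j)"
      proof (cases "M \<ge> 2")
        case True
        have sub: "c (\<phi> i) l \<subset> B (\<phi> i)" for i
          using block_decompositionD(4)[OF D[of "\<phi> i"]] True l m\<phi> by simp
        define d where "d i = (c (\<phi> (\<psi> i)) l, \<mu> (\<phi> (\<psi> i)))" for i
        have "\<exists>i j. i < j \<and> labelled_le R (d i) (d j)"
        proof (rule IH[of d "\<lambda>i. \<phi> (\<psi> i)"])
          have "d i \<in> S" for i
            using sub[of "\<psi> i"] B[of "\<phi> (\<psi> i)"] \<mu>[of "\<phi> (\<psi> i)"] finite_subset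
            unfolding S_def d_def by fastforce
          then show "range d \<subseteq> S" by blast
          show "card (fst (d i)) < card (fst (f (\<phi> (\<psi> i)))) \<and>
            labelled_le R (d i) (f (\<phi> (\<psi> i)))" for i
            unfolding fB d_def
            using psubset_card_mono[OF B(2) sub, of "\<psi> i"]
              labelled_le_subset[OF psubset_imp_subset[OF sub[of "\<psi> i"]]] by simp
        qed
        then show ?thesis unfolding d_def .
      next
        case False
        \<comment> \<open>Only one-point sets remain here, and equal patterns make the map between
          their representatives an embedding.\<close>
        have "c (\<phi> i) l = {t (\<phi> i) l}" for i
          using block_decompositionD(3)[OF D[of "\<phi> i"]] False l m\<phi> by simp
        then have "?le l (\<psi> 0) (\<psi> 1)"
          unfolding labelled_le_def using lab[OF l] rel[OF _ l l]
          by (intro exI[of _ "\<lambda>_. t (\<phi> (\<psi> 1)) l"]) auto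
        then show ?thesis by (meson zero_less_one)
      qed
    qed
    then obtain i j where ij: "i < j" and le: "\<And>l. l < M \<Longrightarrow> ?le l i j" by blast
    have "labelled_le R (B (\<phi> i), \<mu> (\<phi> i)) (B (\<phi> j), \<mu> (\<phi> j))"
    proof (rule labelled_le_blocks[where m = M and c = "c (\<phi> i)" and d = "c (\<phi> j)"])
      fix \<rho> l l' x y x' y'
      assume "\<rho> \<in> set (rels R)" "l < M" "l' < M" "l \<noteq> l'"
        "x \<in> c (\<phi> i) l" "y \<in> c (\<phi> i) l'" "x' \<in> c (\<phi> j) l" "y' \<in> c (\<phi> j) l'"
      then show "(x, y) \<in> \<rho> \<longleftrightarrow> (x', y') \<in> \<rho>"
        using block_decompositionD(5)[OF D[of "\<phi> i"], of \<rho> l l' x y]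
          block_decompositionD(5)[OF D[of "\<phi> j"], of \<rho> l l' x' y'] rel[of \<rho> l l' i j] m\<phi> by simp
    qed (use block_decompositionD(1,2)[OF D[of "\<phi> i"]] block_decompositionD(1,2)[OF D[of "\<phi> j"]]
        le m\<phi> in auto)
    moreover have "\<phi> i < \<phi> j" using ij \<phi>(1) by (simp add: strict_mono_less)
    ultimately show "\<exists>i j. i < j \<and> labelled_le R (f i) (f j)" unfolding fB by blast
  qed
qed

section \<open>Kernels\<close>

text \<open>A finite set whose type is lost with \<open>x\<close>, stated through maps instead of
  types: every injection of \<open>F\<close> avoiding \<open>x\<close> violates some
  relation.\<close>

lemma Ker_witness:
  assumes "x \<in> Ker R"
  obtains F where "F \<subseteq> base R" "finite F"
    "\<And>f. inj_on f F \<Longrightarrow> f ` F \<subseteq> base R - {x} \<Longrightarrow>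
       \<exists>\<rho>\<in>set (rels R). \<exists>y\<in>F. \<exists>z\<in>F. (y, z) \<in> \<rho> \<longleftrightarrow> (f y, f z) \<notin> \<rho>"
proof -
  let ?R' = "restriction R (base R - {x})"
  obtain F where F: "F \<subseteq> base R" "finite F" "iso_type (restriction R F) \<notin> Age ?R'"
    using assms unfolding Ker_def Age_def by blast
  show ?thesis
  proof (rule that[OF F(1,2)], rule ccontr)
    fix f
    assume f: "inj_on f F" "f ` F \<subseteq> base R - {x}"
      and "\<not> (\<exists>\<rho>\<in>set (rels R). \<exists>y\<in>F. \<exists>z\<in>F. (y, z) \<in> \<rho> \<longleftrightarrow> (f y, f z) \<notin> \<rho>)"
    then have "isomorphic (restriction R F) (restriction R (f ` F))"
      by (intro isomorphic_restriction) auto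
    then have "iso_type (restriction R F) = iso_type (restriction ?R' (f ` F))"
      using iso_type_eqI f(2) by (metis restriction_restriction)
    then have "iso_type (restriction R F) \<in> Age ?R'"
      using f(2) F(2) unfolding Age_def by auto
    then show False using F(3) by simp
  qed
qed

text \<open>Deleting a kernel point makes the age a proper hereditary subclass, so ind-minimality
  leaves it only finitely many indecomposable types.\<close>

lemma Ker_indecomposable_bounded:
  assumes "binary_structure k R" "ind_minimal k (Age R)" "a \<in> Ker R"
  obtains N where "\<And>Q. Q \<subseteq> base R - {a} \<Longrightarrow> finite Q \<Longrightarrow> indecomposable (restriction R Q) \<Longrightarrow> card Q \<le> N"
proof -
  let ?R' = "restriction R (base R - {a})"
  have bin: "binary_structure k ?R'" using assms(1) by (rule binary_structure_restriction)
  have "finite (Age ?R' \<inter> Ind_Omega k)"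
    using assms hereditary_Age[OF bin] unfolding ind_minimal_def Ker_def by blast
  from indecomposable_bounded[OF bin this] show ?thesis
    using that by (metis base_restriction restriction_restriction)
qed

theorem theorem5p30:
  fixes k :: nat and R :: "'a bin_struct"
  assumes "k \<ge> 1"
    and "binary_structure k R"
    and "ind_minimal k (Age R)"
  shows "finite (Ker R)"
proof (rule ccontr)
  assume "infinite (Ker R)"
  then obtain u :: "nat \<Rightarrow> 'a" where u: "inj u" "range u \<subseteq> Ker R"
    using infinite_countable_subset by blast
  define a x where "a = u 0" and "x n = u (Suc n)" for n
  have aK: "a \<in> Ker R" and xK: "\<And>n. x n \<in> Ker R" and xa: "\<And>n. x n \<noteq> a"
    and x_eq: "\<And>i j. x i = x j \<longleftrightarrow> i = j"
    using u unfolding a_def x_def by (auto dest: injD)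
  have KE: "Ker R \<subseteq> base R" unfolding Ker_def by blast
  obtain N where N: "\<And>Q. Q \<subseteq> base R - {a} \<Longrightarrow> finite Q \<Longrightarrow> indecomposable (restriction R Q) \<Longrightarrow> card Q \<le> N"
    using Ker_indecomposable_bounded[OF assms(2,3) aK] by blast
  have "\<exists>F. F \<subseteq> base R \<and> finite F \<and> (\<forall>f. inj_on f F \<longrightarrow> f ` F \<subseteq> base R - {x n} \<longrightarrow>
      (\<exists>\<rho>\<in>set (rels R). \<exists>y\<in>F. \<exists>z\<in>F. (y, z) \<in> \<rho> \<longleftrightarrow> (f y, f z) \<notin> \<rho>))" for n
    by (rule Ker_witness[OF xK[of n]]) blast
  then obtain F where F: "\<And>n. F n \<subseteq> base R" "\<And>n. finite (F n)"
    "\<And>n f. inj_on f (F n) \<Longrightarrow> f ` F n \<subseteq> base R - {x n} \<Longrightarrow>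
      \<exists>\<rho>\<in>set (rels R). \<exists>y\<in>F n. \<exists>z\<in>F n. (y, z) \<in> \<rho> \<longleftrightarrow> (f y, f z) \<notin> \<rho>"
    by metis
  \<comment> \<open>The point \<open>a\<close> is taken out because the bound \<open>N\<close> only
    concerns sets avoiding it; it is restored at the end by extending the embedding.\<close>
  define A where "A n = (\<Union>i\<le>n. F i) \<union> x ` {..n} - {a}" for n
  \<comment> \<open>The first two components let an embedding be extended by fixing
    \<open>a\<close>; the others mark \<open>x 0\<close>, ..., \<open>x n\<close> and, among them,
    \<open>x n\<close>. The marked points vary with \<open>n\<close>, but all labels lie in one
    finite set.\<close>
  define \<nu> where "\<nu> n y = ({\<rho> \<in> set (rels R). (a, y) \<in> \<rho>}, {\<rho> \<in> set (rels R). (y, a) \<in> \<rho>},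
    y \<in> x ` {..n}, y = x n)" for n y
  have A: "A n \<subseteq> base R - {a}" "finite (A n)" for n
    using F(1,2) xK KE unfolding A_def by auto
  have xA: "x ` {..n} \<subseteq> A n" for n
    using xa unfolding A_def by auto
  have "\<exists>i j. i < j \<and> labelled_le R (A i, \<nu> i) (A j, \<nu> j)"
  proof (rule labelled_substructures_good)
    show "finite (Pow (set (rels R)) \<times> Pow (set (rels R)) \<times> (UNIV :: (bool \<times> bool) set))" by simp
  qed (use N A in \<open>auto simp: \<nu>_def\<close>)
  then obtain i j g where ij: "i < j" and g: "inj_on g (A i)" "g ` A i \<subseteq> A j"
    "\<And>y. y \<in> A i \<Longrightarrow> \<nu> j (g y) = \<nu> i y"
    "\<And>\<rho> y z. \<rho> \<in> set (rels R) \<Longrightarrow> y \<in> A i \<Longrightarrow> z \<in> A i \<Longrightarrow> (y, z) \<in> \<rho> \<longleftrightarrow> (g y, g z) \<in> \<rho>"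
    unfolding labelled_le_def by auto
  \<comment> \<open>The image of \<open>A i\<close> meets \<open>x ` {..j}\<close> in a set of size \<open>i + 1\<close> that contains \<open>x j\<close>.\<close>
  have "\<exists>l\<le>i. x l \<notin> g ` A i"
  proof (rule ccontr)
    assume "\<not> ?thesis"
    then have all: "x l \<in> g ` A i" if "l \<le> i" for l using that by blast
    \<comment> \<open>If all these points were hit, their preimages would be marked and hence lie
      among \<open>x 0\<close>, ..., \<open>x i\<close>. By counting, \<open>g\<close> would permute
      these points, although it sends \<open>x i\<close> to \<open>x j\<close> with
      \<open>j > i\<close>.\<close>
    have "x ` {..i} \<subseteq> g ` x ` {..i}"
    proof clarify
      fix l assume l: "l \<le> i"
      then obtain y where y: "y \<in> A i" "x l = g y" using all by blast
      have "x l \<in> x ` {..j}" using l ij by simp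
      then have "y \<in> x ` {..i}" using g(3)[OF y(1)] y(2) unfolding \<nu>_def by simp
      then show "x l \<in> g ` x ` {..i}" using y(2) by blast
    qed
    moreover have "card (g ` x ` {..i}) = card (x ` {..i})"
      using g(1) xA by (intro card_image) (rule inj_on_subset)
    ultimately have eq: "g ` x ` {..i} = x ` {..i}"
      by (metis card_subset_eq finite_atMost finite_imageI)
    have "x i \<in> A i" using xA[of i] by blast
    then have "g (x i) = x j" using g(3)[of "x i"] unfolding \<nu>_def by simp
    moreover have "g (x i) \<in> g ` x ` {..i}" by simp
    ultimately have "x j \<in> x ` {..i}" using eq by simp
    then show False using x_eq ij by auto
  qed
  then obtain l where l: "l \<le> i" "x l \<notin> g ` A i" by blast
  \<comment> \<open>The set \<open>F l\<close> may contain \<open>a\<close>, so \<open>g\<close> is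
    extended by fixing \<open>a\<close>. As \<open>x l\<close> differs from \<open>a\<close>, it is
    still missed, which the choice of \<open>F l\<close> forbids.\<close>
  define f where "f = g(a := a)"
  have fa: "f a = a" and fg: "\<And>y. y \<in> A i \<Longrightarrow> f y = g y"
    using A(1)[of i] unfolding f_def by auto
  have FA: "y = a \<or> y \<in> A i" if "y \<in> F l" for y using that l unfolding A_def by blast
  have ga: "g y \<noteq> a" if "y \<in> A i" for y using that g(2) A(1)[of j] by blast
  have "inj_on f (insert a (A i))"
    using g(1) ga fa fg by (fastforce simp: inj_on_def)
  then have f_inj: "inj_on f (F l)" by (rule inj_on_subset) (use FA in blast)
  have f_im: "f ` F l \<subseteq> base R - {x l}"
  proof clarify
    fix y assume "y \<in> F l"
    then consider "y = a" | "y \<in> A i" using FA by blast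
    then show "f y \<in> base R - {x l}"
    proof cases
      case 1
      then show ?thesis using fa xa[of l] aK KE by auto
    next
      case 2
      then have gy: "g y \<in> g ` A i" by (rule imageI)
      then have "g y \<noteq> x l" using l(2) by metis
      moreover have "g y \<in> base R" using subsetD[OF A(1)[of j] subsetD[OF g(2) gy]] by simp
      ultimately show ?thesis using fg[OF 2] by simp
    qed
  qed
  obtain \<rho> y z where \<rho>: "\<rho> \<in> set (rels R)" "y \<in> F l" "z \<in> F l"
    "(y, z) \<in> \<rho> \<longleftrightarrow> (f y, f z) \<notin> \<rho>" using F(3)[OF f_inj f_im] by blast
  have rel_a: "(a, w) \<in> \<rho> \<longleftrightarrow> (a, g w) \<in> \<rho>" "(w, a) \<in> \<rho> \<longleftrightarrow> (g w, a) \<in> \<rho>" if "w \<in> A i" for w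
    using g(3)[OF that] \<rho>(1) unfolding \<nu>_def by auto
  show False
    using FA[OF \<rho>(2)] FA[OF \<rho>(3)] \<rho>(4) g(4)[OF \<rho>(1), of y z] rel_a(1)[of z] rel_a(2)[of y]
      fa fg[of y] fg[of z]
    by (elim disjE) simp_all
qed

end
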